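(* Let $\epsilon>0$ and let $PCR:\mathcal{D}_\epsilon\to \mathrm{SE}(3)$ be the point cloud registration map defined in the context. Then $PCR$ is equivariant to the ordering of its arguments: let $C_2=\{e,\mathfrak{f}\}$ be the group of flips, with $e$ the identity and $\mathfrak{f}$ acting on pairs of point clouds by $\mathfrak{f}(X,Y)=(Y,X)$ and on $\mathrm{SE}(3)$ by $\mathcal{T}\mapsto\mathcal{T}^{-1}$. For every $(X,Y)\in\mathcal{D}_\epsilon$, the pair $\mathfrak{f}(X,Y)$ belongs to $\mathcal{D}_\epsilon$ and $$PCR(\mathfrak{f}(X,Y))=\big(PCR(X,Y)\big)^{-1}.$$
   Context: $\mathrm{SE}(3)$ is the group of rigid motions $\mathcal{T}=(R,T)$, $R\in \mathrm{SO}(3)$, $T\in\mathbb{R}^3$, acting on $\mathbb{R}^3$ by $\mathcal{T}x=Rx+T$; the product is composition. A point cloud is a finite tuple $X=(x_1,\dots,x_N)\in\mathbb{R}^{3\times N}$, $N>0$. Fix $\epsilon>0$. For point clouds $X=(x_1,\dots,x_N)$ (reference), $Y=(y_1,\dots,y_M)$ (source) and $\mathcal{T}\in \mathrm{SE}(3)$, the set of point matches for $\mathcal{T}$ is $C_{\mathcal{T}}(X,Y)=\{(i,j): \|x_i-\mathcal{T}y_j\|_2\le\epsilon\}$. Call $\mathcal{T}$ a registration of $(X,Y)$ if $\mathcal{T}$ is the unique minimizer over $\mathcal{S}\in \mathrm{SE}(3)$ of the Procrustes objective $\sum_{(i,j)\in C_{\mathcal{T}}(X,Y)}\|\mathcal{S}y_j-x_i\|_2^2$.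 Let $\mathcal{D}_\epsilon\subseteq \bigcup_{N>0}\mathbb{R}^{3\times N}\times\bigcup_{M>0}\mathbb{R}^{3\times M}$ be the set of pairs $(X,Y)$ that have exactly one registration (standing assumption of unique alignment), and let $PCR(X,Y)\in \mathrm{SE}(3)$ be that registration. *)

theory Defs
  imports "HOL-Analysis.Analysis" "HOL-Algebra.Group_Action"
begin

type_synonym rigid_motion = "(real ^ 3 ^ 3) \<times> (real ^ 3)"

definition rigid_act :: "rigid_motion \<Rightarrow> real ^ 3 \<Rightarrow> real ^ 3" where
  "rigid_act \<T> x = fst \<T> *v x + snd \<T>"

definition SE3 :: "rigid_motion monoid" where
  "SE3 = \<lparr>carrier = {(R, t). rotation_matrix R},
          mult = (\<lambda>(R, t) (R', t'). (R ** R', R *v t' + t)),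
          one = (mat 1, 0)\<rparr>"

text \<open>The group product is composition of motions.\<close>

lemma rigid_act_mult: "rigid_act (\<S> \<otimes>\<^bsub>SE3\<^esub> \<T>) x = rigid_act \<S> (rigid_act \<T> x)"
  by (simp add: rigid_act_def SE3_def case_prod_beta matrix_vector_mul_assoc
      matrix_vector_right_distrib)

lemma group_SE3: "group SE3"
proof (rule groupI)
  fix \<S> \<T> \<U> assume "\<S> \<in> carrier SE3" "\<T> \<in> carrier SE3" "\<U> \<in> carrier SE3"
  show "\<S> \<otimes>\<^bsub>SE3\<^esub> \<T> \<otimes>\<^bsub>SE3\<^esub> \<U> = \<S> \<otimes>\<^bsub>SE3\<^esub> (\<T> \<otimes>\<^bsub>SE3\<^esub> \<U>)"
    by (simp add: SE3_def case_prod_beta matrix_mul_assoc matrix_vector_mul_assoc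
        matrix_vector_right_distrib)
next
  fix \<T> assume T: "\<T> \<in> carrier SE3"
  obtain R t where RT: "\<T> = (R, t)" and R: "rotation_matrix R"
    using T by (auto simp: SE3_def)
  have "(transpose R, - (transpose R *v t)) \<in> carrier SE3"
    using R by (simp add: SE3_def rotation_matrix_def orthogonal_matrix_transpose det_transpose)
  moreover have "(transpose R, - (transpose R *v t)) \<otimes>\<^bsub>SE3\<^esub> \<T> = \<one>\<^bsub>SE3\<^esub>"
    using R by (simp add: SE3_def RT rotation_matrix_def orthogonal_matrix)
  ultimately show "\<exists>\<S>\<in>carrier SE3. \<S> \<otimes>\<^bsub>SE3\<^esub> \<T> = \<one>\<^bsub>SE3\<^esub>" by blast
qed (auto simp: SE3_def rotation_matrix_def orthogonal_matrix_mul orthogonal_matrix_id det_mul)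

text \<open>A point cloud is a nonempty list; points are indexed from 0 instead of 1.\<close>

type_synonym point_cloud = "(real ^ 3) list"

definition clouds :: "point_cloud set" where
  "clouds = {X. X \<noteq> []}"

definition point_matches ::
  "real \<Rightarrow> rigid_motion \<Rightarrow> point_cloud \<Rightarrow> point_cloud \<Rightarrow> (nat \<times> nat) set" where
  "point_matches \<epsilon> \<T> X Y =
     {(i, j). i < length X \<and> j < length Y \<and> norm (X ! i - rigid_act \<T> (Y ! j)) \<le> \<epsilon>}"

definition procrustes ::
  "(nat \<times> nat) set \<Rightarrow> point_cloud \<Rightarrow> point_cloud \<Rightarrow> rigid_motion \<Rightarrow> real" where
  "procrustes C X Y \<S> = (\<Sum>(i, j)\<in>C. (norm (rigid_act \<S> (Y ! j) - X ! i))\<^sup>2)"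

text \<open>The matches stay those of \<open>\<T>\<close> while the objective is minimized over \<open>\<S>\<close>.\<close>

definition is_registration :: "real \<Rightarrow> point_cloud \<Rightarrow> point_cloud \<Rightarrow> rigid_motion \<Rightarrow> bool" where
  "is_registration \<epsilon> X Y \<T> \<longleftrightarrow>
     (let f = procrustes (point_matches \<epsilon> \<T> X Y) X Y
      in is_arg_min f (\<lambda>\<S>. \<S> \<in> carrier SE3) \<T> \<and>
         (\<forall>\<S>. is_arg_min f (\<lambda>\<S>. \<S> \<in> carrier SE3) \<S> \<longrightarrow> \<S> = \<T>))"

definition PCR_dom :: "real \<Rightarrow> (point_cloud \<times> point_cloud) set" where
  "PCR_dom \<epsilon> = {(X, Y). X \<in> clouds \<and> Y \<in> clouds \<and> (\<exists>!\<T>. is_registration \<epsilon> X Y \<T>)}"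

text \<open>Meaningful on \<^term>\<open>PCR_dom \<epsilon>\<close> only.\<close>

definition PCR :: "real \<Rightarrow> point_cloud \<times> point_cloud \<Rightarrow> rigid_motion" where
  "PCR \<epsilon> p = (THE \<T>. is_registration \<epsilon> (fst p) (snd p) \<T>)"

lemma PCR_in_SE3: "p \<in> PCR_dom \<epsilon> \<Longrightarrow> PCR \<epsilon> p \<in> carrier SE3"
proof -
  assume "p \<in> PCR_dom \<epsilon>"
  then have "\<exists>!\<T>. is_registration \<epsilon> (fst p) (snd p) \<T>"
    by (auto simp: PCR_dom_def)
  from theI'[OF this] show ?thesis
    unfolding PCR_def[symmetric] by (simp add: is_registration_def is_arg_min_def Let_def)
qed

datatype flip = Flip_e | Flip_f

definition flip_group :: "flip monoid" where
  "flip_group = \<lparr>carrier = UNIV,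
                 mult = (\<lambda>g h. if g = h then Flip_e else Flip_f),
                 one = Flip_e\<rparr>"

lemma group_flip_group: "group flip_group"
proof (rule groupI)
  fix g h k :: flip
  show "g \<otimes>\<^bsub>flip_group\<^esub> h \<otimes>\<^bsub>flip_group\<^esub> k = g \<otimes>\<^bsub>flip_group\<^esub> (h \<otimes>\<^bsub>flip_group\<^esub> k)"
    by (cases g; cases h; cases k) (simp_all add: flip_group_def)
  show "\<one>\<^bsub>flip_group\<^esub> \<otimes>\<^bsub>flip_group\<^esub> g = g"
    by (cases g) (simp_all add: flip_group_def)
qed (auto simp: flip_group_def)

fun flip_pair :: "flip \<Rightarrow> point_cloud \<times> point_cloud \<Rightarrow> point_cloud \<times> point_cloud" where
  "flip_pair Flip_e (X, Y) = (X, Y)"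
| "flip_pair Flip_f (X, Y) = (Y, X)"

fun flip_SE3 :: "flip \<Rightarrow> rigid_motion \<Rightarrow> rigid_motion" where
  "flip_SE3 Flip_e \<T> = \<T>"
| "flip_SE3 Flip_f \<T> = inv\<^bsub>SE3\<^esub> \<T>"

text \<open>Library actions are extensional, hence the restrictions below.\<close>

lemma flip_group_actionI:
  assumes c: "\<And>g x. x \<in> A \<Longrightarrow> \<phi> g x \<in> A"
    and e: "\<And>x. x \<in> A \<Longrightarrow> \<phi> Flip_e x = x"
    and f: "\<And>x. x \<in> A \<Longrightarrow> \<phi> Flip_f (\<phi> Flip_f x) = x"
  shows "group_action flip_group A (\<lambda>g. restrict (\<phi> g) A)"
proof -
  have s: "\<phi> g (\<phi> g x) = x" if "x \<in> A" for g x
    using that e f by (cases g) auto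
  have b: "bij_betw (restrict (\<phi> g) A) A A" for g
    by (rule bij_betw_byWitness[where f' = "\<phi> g"]) (auto simp: c s)
  have B: "restrict (\<phi> g) A \<in> Bij A" for g
    using b by (simp add: Bij_def)
  have m: "restrict (\<phi> (g \<otimes>\<^bsub>flip_group\<^esub> h)) A = compose A (restrict (\<phi> g) A) (restrict (\<phi> h) A)"
    for g h
    by (rule ext, cases g; cases h) (auto simp: flip_group_def compose_def c e f)
  have "(\<lambda>g. restrict (\<phi> g) A) \<in> hom flip_group (BijGroup A)"
    by (rule homI) (simp_all add: BijGroup_def B m)
  then show ?thesis
    unfolding group_action_def group_hom_def group_hom_axioms_def
    by (simp add: group_flip_group group_BijGroup)
qed

lemma group_action_flip_pair: "group_action flip_group (clouds \<times> clouds)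
    (\<lambda>g. restrict (flip_pair g) (clouds \<times> clouds))"
proof (rule flip_group_actionI)
  show "flip_pair g p \<in> clouds \<times> clouds" if "p \<in> clouds \<times> clouds" for g p
    using that by (cases p; cases g) auto
qed auto

lemma group_action_flip_SE3: "group_action flip_group (carrier SE3)
    (\<lambda>g. restrict (flip_SE3 g) (carrier SE3))"
proof (rule flip_group_actionI)
  interpret group SE3 by (rule group_SE3)
  show "flip_SE3 g \<T> \<in> carrier SE3" if "\<T> \<in> carrier SE3" for g \<T>
    using that by (cases g) auto
  show "flip_SE3 Flip_f (flip_SE3 Flip_f \<T>) = \<T>" if "\<T> \<in> carrier SE3" for \<T>
    using that by simp
qed simp

end

(* A rigid motion S is an isometry, so the residual of S at (x, y) equals that of its inverse
   at (y, x).  Hence exchanging the two clouds transposes the set of matches and turns the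
   Procrustes objective into its composition with inversion, and inversion carries registrations
   of (X, Y) bijectively to registrations of (Y, X). *)

theory Submission
  imports Defs
begin

interpretation SE3: group SE3
  by (rule group_SE3)

lemma rigid_act_one: "rigid_act \<one>\<^bsub>SE3\<^esub> x = x"
  by (simp add: rigid_act_def SE3_def)

text \<open>The translation cancels in the difference, and the rotation part is orthogonal.\<close>

lemma norm_rigid_act_diff:
  assumes "\<S> \<in> carrier SE3"
  shows "norm (rigid_act \<S> x - rigid_act \<S> y) = norm (x - y)"
proof -
  have "orthogonal_transformation ((*v) (fst \<S>))"
    using assms by (auto simp: SE3_def rotation_matrix_def orthogonal_transformation_matrix)
  then show ?thesis
    by (simp add: rigid_act_def orthogonal_transformation flip: matrix_vector_mult_diff_distrib)
qed

lemma norm_rigid_act_inv: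
  assumes "\<S> \<in> carrier SE3"
  shows "norm (rigid_act (inv\<^bsub>SE3\<^esub> \<S>) x - y) = norm (rigid_act \<S> y - x)"
proof -
  have "norm (rigid_act (inv\<^bsub>SE3\<^esub> \<S>) x - y)
      = norm (rigid_act \<S> (rigid_act (inv\<^bsub>SE3\<^esub> \<S>) x) - rigid_act \<S> y)"
    using assms by (simp add: norm_rigid_act_diff)
  also have "\<dots> = norm (x - rigid_act \<S> y)"
    \<comment> \<open>Merging the two actions into one product gives \<open>\<S>\<close> times its
      inverse, which acts as the identity on \<open>x\<close>.\<close>
    using assms by (simp add: rigid_act_one flip: rigid_act_mult)
  finally show ?thesis
    by (simp add: norm_minus_commute)
qed

lemma point_matches_inv:
  assumes "\<T> \<in> carrier SE3"
  shows "point_matches \<epsilon> (inv\<^bsub>SE3\<^esub> \<T>) Y X = prod.swap ` point_matches \<epsilon> \<T> X Y"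
  using norm_rigid_act_inv[OF assms]
  by (auto simp: point_matches_def image_iff norm_minus_commute)

text \<open>The sum is reindexed along the injective \<open>prod.swap\<close>. The set
  \<open>C\<close> is arbitrary because the matches stay those of one fixed motion while
  \<open>\<S>\<close> varies.\<close>

lemma procrustes_swap_inv:
  assumes "\<S> \<in> carrier SE3"
  shows "procrustes (prod.swap ` C) Y X (inv\<^bsub>SE3\<^esub> \<S>) = procrustes C X Y \<S>"
  using norm_rigid_act_inv[OF assms]
  by (simp add: procrustes_def sum.reindex inj_swap case_prod_beta)

text \<open>Inversion is an involution of SE(3), so the competitors of the inverse of
  \<open>\<T>\<close> are exactly the inverses of the competitors of \<open>\<T>\<close>, with equal
  values.\<close>

lemma is_arg_min_SE3_inv:
  assumes "\<And>\<S>. \<S> \<in> carrier SE3 \<Longrightarrow> g (inv\<^bsub>SE3\<^esub> \<S>) = f \<S>"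
    and "\<T> \<in> carrier SE3"
  shows "is_arg_min g (\<lambda>\<S>. \<S> \<in> carrier SE3) (inv\<^bsub>SE3\<^esub> \<T>)
     \<longleftrightarrow> is_arg_min f (\<lambda>\<S>. \<S> \<in> carrier SE3) \<T>"
  unfolding is_arg_min_def by (metis assms SE3.inv_closed SE3.inv_inv)

lemma is_registration_carrier: "is_registration \<epsilon> X Y \<T> \<Longrightarrow> \<T> \<in> carrier SE3"
  by (simp add: is_registration_def is_arg_min_def Let_def)

text \<open>One implication suffices: exchanging the roles of \<open>X\<close> and \<open>Y\<close>
  yields the converse, since inverting twice returns the motion.\<close>

lemma is_registration_inv:
  assumes "is_registration \<epsilon> X Y \<T>"
  shows "is_registration \<epsilon> Y X (inv\<^bsub>SE3\<^esub> \<T>)"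
proof -
  define C where "C = point_matches \<epsilon> \<T> X Y"
  let ?P = "\<lambda>\<S>. \<S> \<in> carrier SE3"
  have T: "\<T> \<in> carrier SE3"
    using assms by (rule is_registration_carrier)
  have min: "is_arg_min (procrustes C X Y) ?P \<T>"
    using assms by (simp add: is_registration_def C_def Let_def)
  have uniq: "\<S> = \<T>" if "is_arg_min (procrustes C X Y) ?P \<S>" for \<S>
    using assms that by (simp add: is_registration_def C_def Let_def del: split_paired_All)
  have eq: "is_arg_min (procrustes (prod.swap ` C) Y X) ?P (inv\<^bsub>SE3\<^esub> \<S>)
      \<longleftrightarrow> is_arg_min (procrustes C X Y) ?P \<S>" if "\<S> \<in> carrier SE3" for \<S>
    using procrustes_swap_inv that by (rule is_arg_min_SE3_inv)
  have "\<S> = inv\<^bsub>SE3\<^esub> \<T>" if S: "is_arg_min (procrustes (prod.swap ` C) Y X) ?P \<S>" for \<S>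
  proof -
    have "\<S> \<in> carrier SE3"
      using S by (simp add: is_arg_min_def)
    \<comment> \<open>\<open>eq\<close> speaks of minimizers written as inverses, so
      \<open>\<S>\<close> is read as the inverse of its own inverse; \<open>uniq\<close> then
      identifies that inverse with \<open>\<T>\<close>.\<close>
    then show ?thesis
      using S eq[of "inv\<^bsub>SE3\<^esub> \<S>"] uniq[of "inv\<^bsub>SE3\<^esub> \<S>"]
      by (metis SE3.inv_closed SE3.inv_inv)
  qed
  moreover have "is_arg_min (procrustes (prod.swap ` C) Y X) ?P (inv\<^bsub>SE3\<^esub> \<T>)"
    using eq[OF T] min by blast
  ultimately show ?thesis
    unfolding is_registration_def point_matches_inv[OF T] Let_def C_def by blast
qed

lemma PCR_eqI:
  assumes "p \<in> PCR_dom \<epsilon>" and "is_registration \<epsilon> (fst p) (snd p) \<T>"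
  shows "PCR \<epsilon> p = \<T>"
  using assms by (auto simp: PCR_def PCR_dom_def intro: the1_equality)

lemma PCR_swap:
  assumes "(X, Y) \<in> PCR_dom \<epsilon>"
  shows "(Y, X) \<in> PCR_dom \<epsilon>" and "PCR \<epsilon> (Y, X) = inv\<^bsub>SE3\<^esub> (PCR \<epsilon> (X, Y))"
proof -
  obtain \<T> where reg: "is_registration \<epsilon> X Y \<T>"
    and uniq: "\<And>\<S>. is_registration \<epsilon> X Y \<S> \<Longrightarrow> \<S> = \<T>"
    using assms by (auto simp: PCR_dom_def)
  \<comment> \<open>The inverse of \<open>\<S>\<close> registers \<open>(X, Y)\<close>, hence equals
    \<open>\<T>\<close>; inverting again recovers \<open>\<S>\<close> because it lies in
    SE(3).\<close>
  have "\<S> = inv\<^bsub>SE3\<^esub> \<T>" if "is_registration \<epsilon> Y X \<S>" for \<S>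
    using uniq[OF is_registration_inv[OF that]] is_registration_carrier[OF that] by auto
  then have "\<exists>!\<S>. is_registration \<epsilon> Y X \<S>"
    using is_registration_inv[OF reg] by blast
  then show dom: "(Y, X) \<in> PCR_dom \<epsilon>"
    using assms by (simp add: PCR_dom_def)
  have "PCR \<epsilon> (X, Y) = \<T>"
    using assms reg by (simp add: PCR_eqI)
  then show "PCR \<epsilon> (Y, X) = inv\<^bsub>SE3\<^esub> (PCR \<epsilon> (X, Y))"
    using dom is_registration_inv[OF reg] by (simp add: PCR_eqI)
qed

theorem proposition3p2:
  fixes \<epsilon> :: real and X Y :: point_cloud
  assumes "\<epsilon> > 0" and "(X, Y) \<in> PCR_dom \<epsilon>"
  shows "\<forall>g \<in> carrier flip_group.
           flip_pair g (X, Y) \<in> PCR_dom \<epsilon> \<and>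
           PCR \<epsilon> (flip_pair g (X, Y)) = flip_SE3 g (PCR \<epsilon> (X, Y))"
proof
  fix g
  show "flip_pair g (X, Y) \<in> PCR_dom \<epsilon> \<and>
      PCR \<epsilon> (flip_pair g (X, Y)) = flip_SE3 g (PCR \<epsilon> (X, Y))"
    \<comment> \<open>For \<open>Flip_e\<close> both claims reduce to the assumption;
      \<open>Flip_f\<close> is the exchange of the clouds.\<close>
    using assms(2) PCR_swap[OF assms(2)] by (cases g) simp_all
qed

end
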